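(* Let $\mathcal{T}\in\mathbb{C}^{n\times n\times n\times n}$ be a conjugate partial-symmetric tensor. If the unfolding matrix $\mathcal{T}_{[3,2;1,4]}$ is rank-one, then $\mathcal{T}$ is a rank-one tensor.
   Context: A tensor $\mathcal{T}\in\mathbb{C}^{n\times n\times n\times n}$ is conjugate partial-symmetric (CPS) if for all $i,j,k,l$: $\mathcal{T}_{ijkl}=\mathcal{T}_{jikl}=\mathcal{T}_{ijlk}$ and $\mathcal{T}_{ijkl}=\overline{\mathcal{T}_{klij}}$. The unfolding $\mathcal{T}_{[3,2;1,4]}$ is the $n^2\times n^2$ matrix whose rows are indexed by (third index, second index) and columns by (first index, fourth index), i.e. its entry in row $(k,j)$ and column $(i,l)$ is $\mathcal{T}_{ijkl}$. A tensor is rank-one if it is nonzero and of the form $a\circ b\circ c\circ d$ with $a,b,c,d\in\mathbb{C}^n$, where $(a\circ b\circ c\circ d)_{ijkl}=a_ib_jc_kd_l$. *)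

theory Defs
  imports "HOL-Analysis.Analysis"
begin

text \<open>An entry \<open>T\<^sub>i\<^sub>j\<^sub>k\<^sub>l\<close> is written \<open>T $ i $ j $ k $ l\<close>; the dimension \<open>n\<close> is \<open>CARD('n)\<close>.\<close>

type_synonym 'n tensor4 = "complex ^ 'n ^ 'n ^ 'n ^ 'n"

definition cps :: "'n::finite tensor4 \<Rightarrow> bool" where
  "cps T \<longleftrightarrow> (\<forall>i j k l.
     T $ i $ j $ k $ l = T $ j $ i $ k $ l \<and>
     T $ i $ j $ k $ l = T $ i $ j $ l $ k \<and>
     T $ i $ j $ k $ l = cnj (T $ k $ l $ i $ j))"

definition unfold_32_14 :: "'n::finite tensor4 \<Rightarrow> complex ^ ('n \<times> 'n) ^ ('n \<times> 'n)" where
  "unfold_32_14 T = (\<chi> r c. case (r, c) of ((k, j), (i, l)) \<Rightarrow> T $ i $ j $ k $ l)"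

definition outer4 ::
  "complex ^ 'n \<Rightarrow> complex ^ 'n \<Rightarrow> complex ^ 'n \<Rightarrow> complex ^ 'n \<Rightarrow> 'n::finite tensor4" where
  "outer4 a b c d = (\<chi> i j k l. a $ i * b $ j * c $ k * d $ l)"

definition rank_one_tensor :: "'n::finite tensor4 \<Rightarrow> bool" where
  "rank_one_tensor T \<longleftrightarrow> T \<noteq> 0 \<and> (\<exists>a b c d. T = outer4 a b c d)"

end

theory Submission
  imports Defs
begin

text \<open>
  A rank-one unfolding factorises \<open>T\<close> as \<open>T\<^sub>i\<^sub>j\<^sub>k\<^sub>l = U\<^sub>k\<^sub>j V\<^sub>i\<^sub>l\<close> for two matrices \<open>U\<close> and
  \<open>V\<close>. This pairs the index \<open>j\<close> with \<open>k\<close> and \<open>i\<close> with \<open>l\<close>, whereas the symmetry of \<open>T\<close>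
  in \<open>i\<close> and \<open>j\<close> also pairs them the other way: \<open>U\<^sub>k\<^sub>j V\<^sub>i\<^sub>l = U\<^sub>k\<^sub>i V\<^sub>j\<^sub>l\<close>. Fixing \<open>k\<close> and
  \<open>j\<close> at a nonzero entry of \<open>U\<close> separates the variables of \<open>V\<close>, and fixing \<open>i\<close> and \<open>l\<close> at a
  nonzero entry of \<open>V\<close> separates those of \<open>U\<close>. Both matrices therefore have rank one, and
  \<open>T\<close> is a product of four vectors.
\<close>

lemma rank_zero_matrix: "rank (0 :: 'a::field ^ 'n ^ 'm) = 0"
proof -
  have "rows (0 :: 'a ^ 'n ^ 'm) \<subseteq> vec.span {}"
    by (auto simp: rows_def row_def vec_eq_iff)
  then show ?thesis
    using vec.dim_le_card[of "rows (0 :: 'a ^ 'n ^ 'm)" "{}"] by (simp add: row_rank_def_gen)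
qed

text \<open>
  A basis of the row space consists of a single vector \<open>v\<close>, and the coefficients of the rows with
  respect to it form \<open>u\<close>.
\<close>
lemma rank_1_imp_outer_product:
  fixes A :: "'a::field ^ 'n ^ 'm"
  assumes "rank A = 1"
  obtains u v where "\<And>r c. A $ r $ c = u $ r * v $ c"
proof -
  obtain B where B: "rows A \<subseteq> vec.span B" "card B = vec.dim (rows A)"
    using vec.basis_exists by blast
  then have "card B = 1"
    using assms by (simp add: row_rank_def_gen)
  then obtain v where "B = {v}"
    by (auto simp: card_1_singleton_iff)
  have "\<exists>x. A $ r = x *s v" for r
  proof -
    have "A $ r \<in> rows A"
      by (auto simp: rows_def row_def vec_eq_iff)
    then show ?thesis
      using B(1) \<open>B = {v}\<close> by (auto simp: vec.span_singleton)
  qed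
  then obtain f where "\<And>r. A $ r = f r *s v"
    by metis
  then have "\<And>r c. A $ r $ c = (\<chi> r. f r) $ r * v $ c"
    by simp
  then show thesis
    by (rule that)
qed

text \<open>
  The symmetry equates two products whose factors group the four indices differently. Cancelling
  the factor of a fixed nonzero entry expresses \<open>V\<close> by one row of each
  matrix and \<open>U\<close> by one column of each.
\<close>
lemma outer4_of_exchangeable_product:
  fixes T :: "'n::finite tensor4" and U V :: "'n \<Rightarrow> 'n \<Rightarrow> complex"
  assumes T_eq: "\<And>i j k l. T $ i $ j $ k $ l = U k j * V i l"
    and sym: "\<And>i j k l. T $ i $ j $ k $ l = T $ j $ i $ k $ l"
    and "T \<noteq> 0"
  obtains a b c d where "T = outer4 a b c d"
proof -
  obtain p q r s where "T $ p $ q $ r $ s \<noteq> 0"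
    using \<open>T \<noteq> 0\<close> by (auto simp: vec_eq_iff)
  then have nz: "U r q \<noteq> 0" "V p s \<noteq> 0"
    by (auto simp: T_eq)
  have exchange: "U k j * V i l = U k i * V j l" for i j k l
    using sym[of i j k l] by (simp add: T_eq)
  have V: "V i l = U r i * V q l / U r q" for i l
    using exchange[of r q i l] nz by (simp add: field_simps)
  have U: "U k j = U k p * V j s / V p s" for j k
    using exchange[of k j p s] nz by (simp add: field_simps)
  have "T $ i $ j $ k $ l = (U r i / U r q) * (V j s / V p s) * U k p * V q l" for i j k l
    unfolding T_eq using U[of k j] V[of i l] by (simp add: ac_simps)
  then have "T = outer4 (\<chi> i. U r i / U r q) (\<chi> j. V j s / V p s) (\<chi> k. U k p) (\<chi> l. V q l)"
    by (simp add: outer4_def vec_eq_iff)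
  then show thesis
    by (rule that)
qed

theorem lemma16:
  fixes T :: "'n::finite tensor4"
  assumes "cps T"
    and "rank (unfold_32_14 T) = 1"
  shows "rank_one_tensor T"
proof -
  obtain u v where uv: "\<And>r c. unfold_32_14 T $ r $ c = u $ r * v $ c"
    using rank_1_imp_outer_product[OF assms(2)] by blast
  have T_eq: "T $ i $ j $ k $ l = u $ (k, j) * v $ (i, l)" for i j k l
    using uv[of "(k, j)" "(i, l)"] by (simp add: unfold_32_14_def)
  have sym: "T $ i $ j $ k $ l = T $ j $ i $ k $ l" for i j k l
    using assms(1) unfolding cps_def by blast
  have "T \<noteq> 0"
  proof
    assume "T = 0"
    then have "unfold_32_14 T = 0"
      by (auto simp: unfold_32_14_def vec_eq_iff)
    then show False
      using assms(2) by (simp add: rank_zero_matrix)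
  qed
  moreover obtain a b c d where "T = outer4 a b c d"
    by (rule outer4_of_exchangeable_product
        [of T "\<lambda>k j. u $ (k, j)" "\<lambda>i l. v $ (i, l)", OF T_eq sym \<open>T \<noteq> 0\<close>])
  ultimately show ?thesis
    unfolding rank_one_tensor_def by blast
qed

end
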